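(* Let $(X,d)$ be a complete metric space, let $\kappa$ be an $e^{0}$-distance on $X$, let $T:X\to\mathcal{C}(X)$ be a multivalued mapping, and let $\mu:[0,\infty)\to[0,1)$ be an $\mathcal{MT}$-function. Suppose that: (S2) $T$ satisfies one of the following conditions: (H1) $T$ is closed; (H2) the function $f:X\to[0,\infty)$ defined by $f(x)=\kappa(x,Tx)$ is lower semicontinuous; (H3) the function $g:X\to[0,\infty)$ defined by $g(x)=d(x,Tx)$ is lower semicontinuous; (H4) for any sequence $\{x_n\}$ in $X$ with $x_{n+1}\in Tx_n$ for all $n\in\mathbb{N}$ and $\lim_{n\to\infty}x_n=v$, we have $\lim_{n\to\infty}\kappa(x_n,Tv)=0$; (H5) $\inf\{\kappa(x,z)+\kappa(x,Tx):x\in X\}>0$ for every $z\in X$ with $z\notin\mathcal{F}(T)$; and further that (S3) for each $x\in X$, $\kappa(y,Ty)\leq\mu(\kappa(x,y))\,\kappa(x,y)$ for all $y\in Tx$. Then $\mathcal{F}(T)\neq\emptyset$.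
   Context: For a metric space $(X,d)$, $\mathcal{C}(X)$ denotes the class of all nonempty closed subsets of $X$. For a multivalued mapping $T$ on $X$, $\mathcal{F}(T)=\{v\in X: v\in Tv\}$ is its set of fixed points, and $T$ is closed if its graph $\{(x,y)\in X\times X:y\in Tx\}$ is closed in $X\times X$. A function $\kappa:X\times X\to[0,+\infty)$ is an $e$-distance (essential distance) on $(X,d)$ if: ($\tau1$) $\kappa(x,z)\leq\kappa(x,y)+\kappa(y,z)$ for all $x,y,z\in X$; ($\tau2$) if $x\in X$ and $\{y_n\}$ is a sequence in $X$ with $\lim_{n\to\infty}y_n=y$ such that $\kappa(x,y_n)\leq M$ for all $n$, for some $M=M(x)>0$, then $\kappa(x,y)\leq M$; ($\tau3$) for any sequence $\{x_n\}$ in $X$ with $\lim_{n\to\infty}\sup\{\kappa(x_n,x_m):m>n\}=0$, if there exists a sequence $\{y_n\}$ in $X$ such that $\lim_{n\to\infty}\kappa(x_n,y_n)=0$, then $\lim_{n\to\infty}d(x_n,y_n)=0$. Limits of sequences in $X$ and lower semicontinuity are with respect to $d$; $\kappa$ is not assumed symmetric. An $e^{0}$-distance is an $e$-distance $\kappa$ with $\kappa(x,x)=0$ for all $x\in X$. For $x\in X$ and nonempty $C\subseteq X$, $\kappa(x,C)=\inf_{y\in C}\kappa(x,y)$ and $d(x,C)=\inf_{y\in C}d(x,y)$. A function $\mu:[0,\infty)\to[0,1)$ is an $\mathcal{MT}$-function if $\limsup_{s\to t^{+}}\mu(s)<1$ for all $t\in[0,\infty)$. *)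

theory Defs
  imports "HOL-Analysis.Analysis"
begin

(* In e_distance, the supremum in the third axiom is taken in ereal: a real SUP would be
   an unspecified value when the set of the kappa (x n) (x m) is unbounded. *)
definition e_distance :: "('a::metric_space \<Rightarrow> 'a \<Rightarrow> real) \<Rightarrow> bool" where
  "e_distance \<kappa> \<longleftrightarrow>
     (\<forall>x y. 0 \<le> \<kappa> x y) \<and>
     (\<forall>x y z. \<kappa> x z \<le> \<kappa> x y + \<kappa> y z) \<and>
     (\<forall>x ys y M. ys \<longlonglongrightarrow> y \<longrightarrow> M > 0 \<longrightarrow> (\<forall>n::nat. \<kappa> x (ys n) \<le> M) \<longrightarrow> \<kappa> x y \<le> M) \<and>
     (\<forall>xs ys. (\<lambda>n::nat. SUP m\<in>{n<..}. ereal (\<kappa> (xs n) (xs m))) \<longlonglongrightarrow> 0 \<longrightarrow>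
        (\<lambda>n. \<kappa> (xs n) (ys n)) \<longlonglongrightarrow> 0 \<longrightarrow>
        (\<lambda>n. dist (xs n) (ys n)) \<longlonglongrightarrow> 0)"

definition e0_distance :: "('a::metric_space \<Rightarrow> 'a \<Rightarrow> real) \<Rightarrow> bool" where
  "e0_distance \<kappa> \<longleftrightarrow> e_distance \<kappa> \<and> (\<forall>x. \<kappa> x x = 0)"

(* The infimum is meaningful for nonempty C and a function kappa that is bounded below,
   which is the case in all uses. For kappa = dist it is infdist. *)
definition kdist :: "('a \<Rightarrow> 'a \<Rightarrow> real) \<Rightarrow> 'a \<Rightarrow> 'a set \<Rightarrow> real" where
  "kdist \<kappa> x C = (INF y\<in>C. \<kappa> x y)"

definition fixed_points :: "('a \<Rightarrow> 'a set) \<Rightarrow> 'a set" where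
  "fixed_points T = {v. v \<in> T v}"

definition closed_multimap :: "('a::topological_space \<Rightarrow> 'a set) \<Rightarrow> bool" where
  "closed_multimap T \<longleftrightarrow> closed {(x, y). y \<in> T x}"

definition lower_semicontinuous :: "('a::topological_space \<Rightarrow> real) \<Rightarrow> bool" where
  "lower_semicontinuous f \<longleftrightarrow> (\<forall>x. \<forall>a < f x. \<forall>\<^sub>F y in nhds x. a < f y)"

(* Functions on [0, infinity) are represented by functions on the reals;
   only their values at nonnegative arguments are constrained. *)
definition MT_function :: "(real \<Rightarrow> real) \<Rightarrow> bool" where
  "MT_function \<mu> \<longleftrightarrow>
     (\<forall>t\<ge>0. 0 \<le> \<mu> t \<and> \<mu> t < 1) \<and>
     (\<forall>t\<ge>0. Limsup (at_right t) (\<lambda>s. ereal (\<mu> s)) < 1)"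

end

theory Submission
  imports Defs
begin

text \<open>
  Suppose that \<open>T\<close> has no fixed point. Axiom (\<open>\<tau>3\<close>) together with \<open>\<kappa> x x = 0\<close> forces
  \<open>\<kappa> x y > 0\<close> whenever \<open>x \<noteq> y\<close>, hence whenever \<open>y \<in> T x\<close>. The slack between \<open>\<mu>\<close> and
  \<open>(1 + \<mu>) / 2\<close> then lets one choose an orbit \<open>x\<^sub>0, x\<^sub>1, \<dots>\<close> with \<open>x\<^sub>n\<^sub>+\<^sub>1 \<in> T x\<^sub>n\<close>
  along which the steps \<open>a\<^sub>n = \<kappa> x\<^sub>n x\<^sub>n\<^sub>+\<^sub>1\<close> satisfy \<open>a\<^sub>n\<^sub>+\<^sub>1 < (1 + \<mu> a\<^sub>n) / 2 * a\<^sub>n\<close>.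
  The steps decrease strictly, so they approach their limit from the right, and that is where
  the \<open>MT\<close>-condition bounds \<open>\<mu> a\<^sub>n\<close> away from 1 (\<open>MT_function_bounded_along_decreasing\<close>).
  From some index on the steps therefore decay geometrically, which gives,
  for large \<open>n\<close>, \<open>\<kappa> x\<^sub>n x\<^sub>m \<le> b\<^sub>n\<close> for all \<open>m > n\<close>, with \<open>b\<^sub>n\<close> tending to 0 (\<open>fixed_point_free_orbit\<close>).

  By (\<open>\<tau>3\<close>) such an orbit is Cauchy (\<open>e_distance_Cauchy\<close>), and by (\<open>\<tau>2\<close>) its limit \<open>v\<close>
  inherits the bound \<open>\<kappa> x\<^sub>n v \<le> b\<^sub>n\<close>. Each of the five alternatives now puts \<open>v\<close> into \<open>T v\<close>,
  contrary to the assumption.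
  For the ones that speak of \<open>\<kappa>\<close>-distances to \<open>T v\<close>, the passage from a vanishing
  \<open>\<kappa>\<close>-distance to membership in a closed set is again (\<open>\<tau>3\<close>) (\<open>e_distance_limit_in_closed\<close>):
  it is applied to the orbit itself or to the constant sequence \<open>v\<close>. In the last alternative
  the bound on \<open>\<kappa> x\<^sub>n v\<close> makes the infimum for \<open>z = v\<close> vanish along the orbit.
\<close>

lemma e_distance_nonneg: "e_distance \<kappa> \<Longrightarrow> 0 \<le> \<kappa> x y"
  unfolding e_distance_def by blast

lemma e_distance_triangle: "e_distance \<kappa> \<Longrightarrow> \<kappa> x z \<le> \<kappa> x y + \<kappa> y z"
  unfolding e_distance_def by blast

lemma e_distance_bound_limit:
  assumes "e_distance \<kappa>" and "ys \<longlonglongrightarrow> y" and "M > 0" and "\<And>n::nat. \<kappa> x (ys n) \<le> M"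
  shows "\<kappa> x y \<le> M"
  using assms unfolding e_distance_def by blast

text \<open>A real null sequence that eventually dominates the \<open>\<kappa>\<close>-distances to all later terms
  squeezes their extended real suprema to 0, so the third axiom applies. In this form its
  hypothesis can be read off from a geometric estimate.\<close>

lemma e_distance_dist_tendsto_0:
  fixes xs ys :: "nat \<Rightarrow> 'a::metric_space"
  assumes e: "e_distance \<kappa>"
    and b: "b \<longlonglongrightarrow> 0" and bound: "\<forall>\<^sub>F n in sequentially. \<forall>m>n. \<kappa> (xs n) (xs m) \<le> b n"
    and ys: "(\<lambda>n. \<kappa> (xs n) (ys n)) \<longlonglongrightarrow> 0"
  shows "(\<lambda>n. dist (xs n) (ys n)) \<longlonglongrightarrow> 0"
proof -
  have "(\<lambda>n. SUP m\<in>{n<..}. ereal (\<kappa> (xs n) (xs m))) \<longlonglongrightarrow> 0"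
  proof (rule tendsto_sandwich)
    show "\<forall>\<^sub>F n in sequentially. 0 \<le> (SUP m\<in>{n<..}. ereal (\<kappa> (xs n) (xs m)))"
    proof (intro always_eventually allI)
      fix n
      have "Suc n \<in> {n<..}" by simp
      moreover have "0 \<le> ereal (\<kappa> (xs n) (xs (Suc n)))"
        using e_distance_nonneg[OF e] by simp
      ultimately show "0 \<le> (SUP m\<in>{n<..}. ereal (\<kappa> (xs n) (xs m)))"
        by (rule SUP_upper2)
    qed
    show "\<forall>\<^sub>F n in sequentially. (SUP m\<in>{n<..}. ereal (\<kappa> (xs n) (xs m))) \<le> ereal (b n)"
      using bound by eventually_elim (auto intro!: SUP_least)
    show "(\<lambda>n. ereal (b n)) \<longlonglongrightarrow> 0"
      using b by (simp add: zero_ereal_def)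
  qed simp
  then show ?thesis
    using e ys unfolding e_distance_def by blast
qed

text \<open>If \<open>xs\<close> were not Cauchy, infinitely many \<open>xs n\<close> would have a later term at distance at
  least \<open>\<epsilon>\<close>. The sequence of these later terms contradicts the third axiom.\<close>

lemma e_distance_Cauchy:
  fixes xs :: "nat \<Rightarrow> 'a::metric_space"
  assumes e: "e_distance \<kappa>"
    and b: "b \<longlonglongrightarrow> 0" and bound: "\<forall>\<^sub>F n in sequentially. \<forall>m>n. \<kappa> (xs n) (xs m) \<le> b n"
  shows "Cauchy xs"
  unfolding Cauchy_altdef
proof (intro allI impI)
  fix \<epsilon> :: real
  assume "\<epsilon> > 0"
  have "\<forall>n. \<exists>m>n. (\<exists>k>n. \<not> dist (xs n) (xs k) < \<epsilon>) \<longrightarrow> \<not> dist (xs n) (xs m) < \<epsilon>"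
    by (meson lessI)
  then obtain m where m: "\<And>n. m n > n"
    and far: "\<And>n k. k > n \<Longrightarrow> \<not> dist (xs n) (xs k) < \<epsilon> \<Longrightarrow> \<not> dist (xs n) (xs (m n)) < \<epsilon>"
    by metis
  have "(\<lambda>n. \<kappa> (xs n) (xs (m n))) \<longlonglongrightarrow> 0"
  proof (rule tendsto_sandwich[OF _ _ tendsto_const b])
    show "\<forall>\<^sub>F n in sequentially. 0 \<le> \<kappa> (xs n) (xs (m n))"
      by (simp add: e_distance_nonneg[OF e])
    show "\<forall>\<^sub>F n in sequentially. \<kappa> (xs n) (xs (m n)) \<le> b n"
      using bound by eventually_elim (simp add: m)
  qed
  with e b bound have "(\<lambda>n. dist (xs n) (xs (m n))) \<longlonglongrightarrow> 0"
    by (rule e_distance_dist_tendsto_0)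
  then have "\<forall>\<^sub>F n in sequentially. dist (xs n) (xs (m n)) < \<epsilon>"
    using \<open>\<epsilon> > 0\<close> by (rule order_tendstoD)
  then obtain N where "\<And>n. n \<ge> N \<Longrightarrow> dist (xs n) (xs (m n)) < \<epsilon>"
    by (auto simp: eventually_sequentially)
  with far show "\<exists>N. \<forall>n\<ge>N. \<forall>k>n. dist (xs n) (xs k) < \<epsilon>"
    by blast
qed

lemma e0_distance_eq_0_imp_eq:
  assumes "e0_distance \<kappa>" and "\<kappa> x y = 0"
  shows "x = y"
proof -
  have "(\<lambda>n::nat. dist x y) \<longlonglongrightarrow> 0"
    using assms
    by (intro e_distance_dist_tendsto_0[where \<kappa> = \<kappa> and b = "\<lambda>_. 0"])
       (auto simp: e0_distance_def)
  then show ?thesis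
    by (simp add: LIMSEQ_const_iff)
qed

lemma kdist_nonneg:
  assumes "e_distance \<kappa>" and "C \<noteq> {}"
  shows "0 \<le> kdist \<kappa> x C"
  unfolding kdist_def using assms by (intro cINF_greatest) (auto simp: e_distance_nonneg)

lemma kdist_le:
  assumes "e_distance \<kappa>" and "y \<in> C"
  shows "kdist \<kappa> x C \<le> \<kappa> x y"
  unfolding kdist_def using assms
  by (intro cINF_lower bdd_belowI2[where m = 0]) (auto simp: e_distance_nonneg)

lemma kdist_lessE:
  assumes "e_distance \<kappa>" and "C \<noteq> {}" and "kdist \<kappa> x C < r"
  obtains y where "y \<in> C" and "\<kappa> x y < r"
proof -
  have "bdd_below (\<kappa> x ` C)"
    using assms(1) by (intro bdd_belowI2[where m = 0]) (auto simp: e_distance_nonneg)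
  then show thesis
    using assms(2,3) that by (auto simp: kdist_def cINF_less_iff)
qed

text \<open>Near-minimisers \<open>ys n\<close> of the \<open>\<kappa>\<close>-distance from \<open>xs n\<close> to \<open>C\<close> stay metrically close to
  \<open>xs n\<close> by the third axiom, so they converge to the same limit within \<open>C\<close>.\<close>

lemma e_distance_limit_in_closed:
  fixes xs :: "nat \<Rightarrow> 'a::metric_space"
  assumes e: "e_distance \<kappa>"
    and b: "b \<longlonglongrightarrow> 0" and bound: "\<forall>\<^sub>F n in sequentially. \<forall>m>n. \<kappa> (xs n) (xs m) \<le> b n"
    and xs: "xs \<longlonglongrightarrow> v" and C: "closed C" "C \<noteq> {}"
    and kd: "(\<lambda>n. kdist \<kappa> (xs n) C) \<longlonglongrightarrow> 0"
  shows "v \<in> C"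
proof -
  have "\<exists>y\<in>C. \<kappa> (xs n) y < kdist \<kappa> (xs n) C + inverse (real (Suc n))" for n
    using kdist_lessE[OF e C(2), of "xs n" "kdist \<kappa> (xs n) C + inverse (real (Suc n))"]
    by fastforce
  then obtain ys where ys: "\<And>n. ys n \<in> C"
    and near: "\<And>n. \<kappa> (xs n) (ys n) < kdist \<kappa> (xs n) C + inverse (real (Suc n))"
    by metis
  have "(\<lambda>n. \<kappa> (xs n) (ys n)) \<longlonglongrightarrow> 0"
  proof (rule tendsto_sandwich[OF _ _ tendsto_const])
    show "(\<lambda>n. kdist \<kappa> (xs n) C + inverse (real (Suc n))) \<longlonglongrightarrow> 0"
      using tendsto_add[OF kd LIMSEQ_inverse_real_of_nat] by simp
    show "\<forall>\<^sub>F n in sequentially. 0 \<le> \<kappa> (xs n) (ys n)"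
      by (simp add: e_distance_nonneg[OF e])
    show "\<forall>\<^sub>F n in sequentially.
        \<kappa> (xs n) (ys n) \<le> kdist \<kappa> (xs n) C + inverse (real (Suc n))"
      by (intro always_eventually allI less_imp_le near)
  qed
  with e b bound have "(\<lambda>n. dist (xs n) (ys n)) \<longlonglongrightarrow> 0"
    by (rule e_distance_dist_tendsto_0)
  then have lim: "(\<lambda>n. dist (xs n) (ys n) + dist (xs n) v) \<longlonglongrightarrow> 0"
    using tendsto_add[OF _ tendsto_dist[OF xs tendsto_const[of v]]] by fastforce
  have "dist (ys n) v \<le> dist (xs n) (ys n) + dist (xs n) v" for n
    by (rule dist_triangle3)
  then have "(\<lambda>n. dist (ys n) v) \<longlonglongrightarrow> 0"
    by (intro tendsto_sandwich[OF _ _ tendsto_const lim]) simp_all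
  then have "ys \<longlonglongrightarrow> v"
    by (simp add: tendsto_dist_iff[of ys])
  with C(1) ys show ?thesis
    by (meson closed_sequentially)
qed

text \<open>A strictly decreasing sequence stays strictly to the right of its limit, which is where
  the one-sided upper limit in the definition of an \<open>MT\<close>-function controls \<open>\<mu>\<close>.\<close>

lemma MT_function_bounded_along_decreasing:
  assumes mu: "MT_function \<mu>"
    and pos: "\<And>n::nat. 0 \<le> a n" and dec: "\<And>n. a (Suc n) < a n"
  obtains c where "c < 1" and "\<forall>\<^sub>F n in sequentially. \<mu> (a n) < c"
proof -
  have "decseq a"
    using dec by (simp add: decseq_Suc_iff less_imp_le)
  then obtain t where t: "a \<longlonglongrightarrow> t" and ge: "\<And>n. t \<le> a n"
    using decseq_convergent[of a 0] pos by blast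
  have gt: "t < a n" for n
    using ge[of "Suc n"] dec[of n] by linarith
  have "t \<ge> 0"
    using t pos by (intro LIMSEQ_le_const) auto
  then have "Limsup (at_right t) (\<lambda>s. ereal (\<mu> s)) < 1"
    using mu by (simp add: MT_function_def)
  then obtain c where c: "Limsup (at_right t) (\<lambda>s. ereal (\<mu> s)) < ereal c" "ereal c < 1"
    using ereal_dense2 by blast
  from c(1) have "\<forall>\<^sub>F s in at_right t. \<mu> s < c"
    by (auto dest: Limsup_lessD)
  moreover have "filterlim a (at_right t) sequentially"
    using t gt by (simp add: filterlim_at less_imp_neq[OF gt, symmetric])
  ultimately have "\<forall>\<^sub>F n in sequentially. \<mu> (a n) < c"
    by (rule eventually_compose_filterlim)
  with c(2) that show thesis by simp
qed

text \<open>The bound is the full geometric series that dominates the steps. Being independent of \<open>k\<close>, it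
  reproduces itself when one step is split off at the front, so no partial sums are needed.\<close>

lemma geometric_decay_tail_bound:
  fixes \<kappa> :: "'a \<Rightarrow> 'a \<Rightarrow> real"
  assumes refl: "\<And>x. \<kappa> x x = 0" and tri: "\<And>x y z. \<kappa> x z \<le> \<kappa> x y + \<kappa> y z"
    and nonneg: "\<And>x y. 0 \<le> \<kappa> x y" and "c < 1"
    and decay: "\<And>n. n \<ge> N \<Longrightarrow> \<kappa> (x (Suc n)) (x (Suc (Suc n))) \<le> c * \<kappa> (x n) (x (Suc n))"
    and "n \<ge> N"
  shows "\<kappa> (x n) (x (n + k)) \<le> \<kappa> (x n) (x (Suc n)) / (1 - c)"
  using \<open>n \<ge> N\<close>
proof (induction k arbitrary: n)
  case 0
  then show ?case
    using \<open>c < 1\<close> by (simp add: refl nonneg)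
next
  case (Suc k)
  let ?a = "\<lambda>n. \<kappa> (x n) (x (Suc n))"
  have "\<kappa> (x n) (x (n + Suc k)) \<le> ?a n + \<kappa> (x (Suc n)) (x (Suc n + k))"
    using tri[of "x n" "x (n + Suc k)" "x (Suc n)"] by simp
  also have "\<dots> \<le> ?a n + ?a (Suc n) / (1 - c)"
    using Suc.IH[of "Suc n"] Suc.prems by simp
  also have "\<dots> \<le> ?a n + c * ?a n / (1 - c)"
    using decay[OF Suc.prems] \<open>c < 1\<close> by (simp add: divide_right_mono)
  also have "\<dots> = ?a n / (1 - c)"
    using \<open>c < 1\<close> by (simp add: field_simps)
  finally show ?case .
qed

text \<open>Fixed point freeness makes all steps \<open>\<kappa> y z\<close> with \<open>z \<in> T y\<close> positive. This gives
  room for the infimum in \<open>kdist \<kappa> y (T y)\<close> to be approximated by an element of \<open>T y\<close> at the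
  price of replacing \<open>\<mu>\<close> by \<open>(1 + \<mu>) / 2\<close>, which is still below 1. The bounds \<open>b n\<close> are
  positive because the second axiom passes only positive bounds on to limits.\<close>

lemma fixed_point_free_orbit:
  fixes \<kappa> :: "'a::metric_space \<Rightarrow> 'a \<Rightarrow> real"
  assumes kappa: "e0_distance \<kappa>" and ne: "\<And>x. T x \<noteq> {}"
    and mu: "MT_function \<mu>"
    and contr: "\<And>x y. y \<in> T x \<Longrightarrow> kdist \<kappa> y (T y) \<le> \<mu> (\<kappa> x y) * \<kappa> x y"
    and no_fix: "fixed_points T = {}"
  obtains x :: "nat \<Rightarrow> 'a" and b :: "nat \<Rightarrow> real"
  where "\<And>n. x (Suc n) \<in> T (x n)" and "b \<longlonglongrightarrow> 0" and "\<And>n. 0 < b n"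
    and "\<forall>\<^sub>F n in sequentially. \<forall>m>n. \<kappa> (x n) (x m) \<le> b n"
proof -
  have e: "e_distance \<kappa>" and refl: "\<And>x. \<kappa> x x = 0"
    using kappa by (auto simp: e0_distance_def)
  note nonneg = e_distance_nonneg[OF e]
  have pos: "0 < \<kappa> x y" if "y \<in> T x" for x y
  proof -
    have "x \<noteq> y"
      using that no_fix by (auto simp: fixed_points_def)
    then have "\<kappa> x y \<noteq> 0"
      using e0_distance_eq_0_imp_eq[OF kappa] by blast
    then show ?thesis
      using nonneg[of x y] by linarith
  qed
  have mu_less_1: "\<mu> (\<kappa> x y) < 1" for x y
    using mu nonneg[of x y] by (simp add: MT_function_def)
  have step: "\<exists>z\<in>T y. \<kappa> y z < (1 + \<mu> (\<kappa> x y)) / 2 * \<kappa> x y" if "y \<in> T x" for x y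
  proof -
    have "\<mu> (\<kappa> x y) * \<kappa> x y < (1 + \<mu> (\<kappa> x y)) / 2 * \<kappa> x y"
      using pos[OF that] mu_less_1[of x y] by (intro mult_strict_right_mono) auto
    with contr[OF that] have "kdist \<kappa> y (T y) < (1 + \<mu> (\<kappa> x y)) / 2 * \<kappa> x y"
      by (rule le_less_trans)
    then show ?thesis
      by (rule kdist_lessE[OF e ne]) blast
  qed
  \<comment> \<open>The choice of the next point depends on the two preceding ones, so the recursion runs on
      consecutive pairs.\<close>
  define Q where "Q p q \<longleftrightarrow> fst q = snd p \<and>
    \<kappa> (fst q) (snd q) < (1 + \<mu> (\<kappa> (fst p) (snd p))) / 2 * \<kappa> (fst p) (snd p)" for p q
  obtain p where p: "\<And>n::nat. snd (p n) \<in> T (fst (p n))" and Q: "\<And>n. Q (p n) (p (Suc n))"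
  proof -
    have "\<exists>p. snd p \<in> T (fst p)"
      using ne[of undefined] by auto
    moreover have "\<exists>q. snd q \<in> T (fst q) \<and> Q p q" if "snd p \<in> T (fst p)" for p
      using step[OF that] unfolding Q_def by (metis fst_conv snd_conv)
    ultimately show thesis
      using dependent_nat_choice[of "\<lambda>_ p. snd p \<in> T (fst p)" "\<lambda>_. Q"] that by auto
  qed
  define x where "x n = fst (p n)" for n
  define a where "a n = \<kappa> (x n) (x (Suc n))" for n
  have snd_p: "snd (p n) = x (Suc n)" for n
    using Q[of n] by (simp add: Q_def x_def)
  have orbit: "x (Suc n) \<in> T (x n)" for n
    using p[of n] by (simp add: snd_p x_def)
  have a_pos: "0 < a n" for n
    using pos[OF orbit[of n]] by (simp add: a_def)
  have a_step: "a (Suc n) < (1 + \<mu> (a n)) / 2 * a n" for n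
    using Q[of n] unfolding Q_def snd_p by (simp add: a_def x_def)
  have "(1 + \<mu> (a n)) / 2 * a n < 1 * a n" for n
    using a_pos[of n] mu_less_1[of "x n" "x (Suc n)"]
    by (intro mult_strict_right_mono) (auto simp: a_def)
  with a_step have a_dec: "a (Suc n) < a n" for n
    by (metis less_trans mult_1)
  obtain c where c: "c < 1" and "\<forall>\<^sub>F n in sequentially. \<mu> (a n) < c"
    using MT_function_bounded_along_decreasing[of \<mu> a] mu a_pos a_dec less_imp_le by metis
  then obtain N where N: "\<And>n. n \<ge> N \<Longrightarrow> \<mu> (a n) < c"
    by (auto simp: eventually_sequentially)
  define r where "r = (1 + c) / 2"
  have r: "r < 1"
    using c by (simp add: r_def)
  have decay: "a (Suc n) \<le> r * a n" if "n \<ge> N" for n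
  proof -
    have "(1 + \<mu> (a n)) / 2 * a n \<le> r * a n"
      using N[OF that] a_pos[of n] by (intro mult_right_mono) (auto simp: r_def)
    with a_step[of n] show ?thesis by linarith
  qed
  have "a \<longlonglongrightarrow> 0"
  proof -
    have "decseq a"
      using a_dec by (simp add: decseq_Suc_iff less_imp_le)
    then obtain t where t: "a \<longlonglongrightarrow> t"
      using decseq_convergent[of a 0] a_pos less_imp_le by metis
    have "t \<ge> 0"
      using t a_pos by (intro LIMSEQ_le_const) (auto intro: less_imp_le)
    have "t \<le> r * t"
      using LIMSEQ_Suc[OF t] tendsto_mult_left[OF t] decay
      by (intro LIMSEQ_le[where X = "\<lambda>n. a (Suc n)" and Y = "\<lambda>n. r * a n"]) auto
    then have "t = 0"
      using \<open>t \<ge> 0\<close> r mult_strict_right_mono[of r 1 t] by linarith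
    with t show ?thesis by simp
  qed
  show thesis
  proof (rule that)
    show "x (Suc n) \<in> T (x n)" for n by (rule orbit)
    show "(\<lambda>n. a n / (1 - r)) \<longlonglongrightarrow> 0"
      using tendsto_divide[OF \<open>a \<longlonglongrightarrow> 0\<close> tendsto_const, of "1 - r"] r by simp
    show "0 < a n / (1 - r)" for n
      using a_pos[of n] r by simp
    have "\<kappa> (x n) (x m) \<le> a n / (1 - r)" if "n \<ge> N" "m > n" for n m
      using geometric_decay_tail_bound[of \<kappa> r N x n "m - n"] refl nonneg
        e_distance_triangle[OF e] r decay that
      by (simp add: a_def)
    then show "\<forall>\<^sub>F n in sequentially. \<forall>m>n. \<kappa> (x n) (x m) \<le> a n / (1 - r)"
      unfolding eventually_sequentially by blast
  qed
qed

lemma lower_semicontinuous_limit_le: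
  fixes xs :: "nat \<Rightarrow> 'a::topological_space"
  assumes f: "lower_semicontinuous f" and xs: "xs \<longlonglongrightarrow> v" and lim: "(\<lambda>n. f (xs n)) \<longlonglongrightarrow> l"
  shows "f v \<le> l"
proof (rule ccontr)
  assume "\<not> f v \<le> l"
  then obtain s where s: "l < s" "s < f v"
    using dense[of l "f v"] by auto
  have "\<forall>\<^sub>F y in nhds v. s < f y"
    using f s(2) by (simp add: lower_semicontinuous_def)
  then have "\<forall>\<^sub>F n in sequentially. s < f (xs n)"
    using xs by (rule eventually_compose_filterlim)
  moreover have "\<forall>\<^sub>F n in sequentially. f (xs n) < s"
    using lim s(1) by (rule order_tendstoD)
  ultimately have "\<forall>\<^sub>F n::nat in sequentially. False"
    by eventually_elim simp
  then show False by simp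
qed

theorem theorem2p2:
  fixes \<kappa> :: "'a::complete_space \<Rightarrow> 'a \<Rightarrow> real"
    and T :: "'a \<Rightarrow> 'a set"
    and \<mu> :: "real \<Rightarrow> real"
  assumes kappa: "e0_distance \<kappa>"
    and T_values: "\<And>x. T x \<noteq> {} \<and> closed (T x)"
    and mu: "MT_function \<mu>"
    and S2: "closed_multimap T
      \<or> lower_semicontinuous (\<lambda>x. kdist \<kappa> x (T x))
      \<or> lower_semicontinuous (\<lambda>x. infdist x (T x))
      \<or> (\<forall>(x :: nat \<Rightarrow> 'a) v. (\<forall>n. x (Suc n) \<in> T (x n)) \<longrightarrow> x \<longlonglongrightarrow> v \<longrightarrow>
            (\<lambda>n. kdist \<kappa> (x n) (T v)) \<longlonglongrightarrow> 0)
      \<or> (\<forall>z. z \<notin> fixed_points T \<longrightarrow> (INF x. \<kappa> x z + kdist \<kappa> x (T x)) > 0)"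
    and S3: "\<And>x y. y \<in> T x \<Longrightarrow> kdist \<kappa> y (T y) \<le> \<mu> (\<kappa> x y) * \<kappa> x y"
  shows "fixed_points T \<noteq> {}"
proof
  assume no_fix: "fixed_points T = {}"
  have e: "e_distance \<kappa>" and refl: "\<And>x. \<kappa> x x = 0"
    using kappa by (auto simp: e0_distance_def)
  note nonneg = e_distance_nonneg[OF e]
  have ne: "\<And>x. T x \<noteq> {}" and cl: "\<And>x. closed (T x)"
    using T_values by auto
  obtain x b where orbit: "\<And>n::nat. x (Suc n) \<in> T (x n)"
    and b: "b \<longlonglongrightarrow> 0" and b_pos: "\<And>n. 0 < b n"
    and bound: "\<forall>\<^sub>F n in sequentially. \<forall>m>n. \<kappa> (x n) (x m) \<le> b n"
    by (rule fixed_point_free_orbit[OF kappa ne mu S3 no_fix]) (assumption, rule that)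
  obtain v where v: "x \<longlonglongrightarrow> v"
    using e_distance_Cauchy[OF e b bound] Cauchy_convergent unfolding convergent_def by blast
  have v_Suc: "(\<lambda>n. x (Suc n)) \<longlonglongrightarrow> v"
    using v by (rule LIMSEQ_Suc)
  have not_fix: "v \<notin> T v"
    using no_fix by (auto simp: fixed_points_def)
  have kd: "(\<lambda>n. kdist \<kappa> (x n) (T (x n))) \<longlonglongrightarrow> 0"
  proof (rule tendsto_sandwich[OF _ _ tendsto_const b])
    show "\<forall>\<^sub>F n in sequentially. 0 \<le> kdist \<kappa> (x n) (T (x n))"
      by (simp add: kdist_nonneg[OF e ne])
    show "\<forall>\<^sub>F n in sequentially. kdist \<kappa> (x n) (T (x n)) \<le> b n"
      using bound by eventually_elim (meson kdist_le[OF e orbit] lessI order_trans)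
  qed
  from S2 consider
      (H1) "closed_multimap T"
    | (H2) "lower_semicontinuous (\<lambda>x. kdist \<kappa> x (T x))"
    | (H3) "lower_semicontinuous (\<lambda>x. infdist x (T x))"
    | (H4) "\<And>(x :: nat \<Rightarrow> 'a) v. (\<And>n. x (Suc n) \<in> T (x n)) \<Longrightarrow> x \<longlonglongrightarrow> v \<Longrightarrow>
        (\<lambda>n. kdist \<kappa> (x n) (T v)) \<longlonglongrightarrow> 0"
    | (H5) "\<And>z. z \<notin> fixed_points T \<Longrightarrow> (INF x. \<kappa> x z + kdist \<kappa> x (T x)) > 0"
    by blast
  then have "v \<in> T v"
  proof cases
    case H1
    have "(v, v) \<in> {(x, y). y \<in> T x}"
    proof (rule closed_sequentially)
      show "closed {(x, y). y \<in> T x}"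
        using H1 by (simp add: closed_multimap_def)
      show "(\<lambda>n. (x n, x (Suc n))) \<longlonglongrightarrow> (v, v)"
        using v v_Suc by (rule tendsto_Pair)
    qed (simp add: orbit)
    then show ?thesis by simp
  next
    case H2
    from lower_semicontinuous_limit_le[OF H2 v kd] have "kdist \<kappa> v (T v) = 0"
      using kdist_nonneg[OF e ne] by (intro antisym) auto
    then show ?thesis
      using e_distance_limit_in_closed[of \<kappa> "\<lambda>_. 0" "\<lambda>_. v" v "T v"] e refl cl ne by simp
  next
    case H3
    have "(\<lambda>n. infdist (x n) (T (x n))) \<longlonglongrightarrow> 0"
    proof (rule tendsto_sandwich[OF _ _ tendsto_const])
      show "(\<lambda>n. dist (x n) (x (Suc n))) \<longlonglongrightarrow> 0"
        using tendsto_dist[OF v v_Suc] by simp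
    qed (simp_all add: infdist_nonneg infdist_le orbit)
    from lower_semicontinuous_limit_le[OF H3 v this] have "infdist v (T v) = 0"
      using infdist_nonneg[of v "T v"] by linarith
    then show ?thesis
      using in_closed_iff_infdist_zero[OF cl ne] by simp
  next
    case H4
    from H4[OF orbit v] show ?thesis
      by (rule e_distance_limit_in_closed[OF e b bound v cl ne])
  next
    case H5
    let ?h = "\<lambda>x. \<kappa> x v + kdist \<kappa> x (T x)"
    have "(\<lambda>n. \<kappa> (x n) v) \<longlonglongrightarrow> 0"
    proof (rule tendsto_sandwich[OF _ _ tendsto_const b])
      show "\<forall>\<^sub>F n in sequentially. 0 \<le> \<kappa> (x n) v"
        by (simp add: nonneg)
      show "\<forall>\<^sub>F n in sequentially. \<kappa> (x n) v \<le> b n"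
        using bound
      proof eventually_elim
        case (elim n)
        \<comment> \<open>Shifting past \<open>n\<close> makes the bound hold at every index, as the second axiom demands.\<close>
        have "(\<lambda>k. x (k + Suc n)) \<longlonglongrightarrow> v"
          using v by (rule LIMSEQ_ignore_initial_segment)
        then show ?case
          using b_pos by (rule e_distance_bound_limit[OF e]) (simp add: elim)
      qed
    qed
    then have "(\<lambda>n. ?h (x n)) \<longlonglongrightarrow> 0"
      using tendsto_add[OF _ kd] by fastforce
    moreover have "bdd_below (range ?h)"
      using nonneg kdist_nonneg[OF e ne] by (intro bdd_belowI2[where m = 0]) (auto intro: add_nonneg_nonneg)
    then have "(INF x. ?h x) \<le> ?h (x n)" for n
      by (intro cINF_lower) auto
    ultimately have "(INF x. ?h x) \<le> 0"
      by (intro LIMSEQ_le_const) auto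
    moreover have "(INF x. ?h x) > 0"
      using H5[of v] no_fix by simp
    ultimately show ?thesis by simp
  qed
  with not_fix show False by simp
qed

end
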